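(* Let $K\subset\mathbb{R}^2$ be a convex body and write $r=r(K)$, $w=w(K)$, $D=D(K)$, $R=R(K)$. Then \[ w\ \le\ r\left(1+\frac{2\sqrt{2}\,R}{D}\sqrt{1+\sqrt{1-\left(\frac{D}{2R}\right)^2}}\right). \]
   Context: For a convex body $K\subset\mathbb{R}^n$: $D(K)$ is the largest distance between two points of $K$; $w(K)$ is the smallest distance between two distinct parallel supporting lines/hyperplanes of $K$; $r(K)$ is the radius of a largest Euclidean ball contained in $K$; $R(K)$ is the radius of the smallest Euclidean ball containing $K$. *)

theory Defs
  imports "HOL-Analysis.Analysis"
begin

definition convex_body :: "'a::euclidean_space set \<Rightarrow> bool" where
  "convex_body K \<longleftrightarrow> convex K \<and> compact K \<and> interior K \<noteq> {}"

definition diam :: "'a::euclidean_space set \<Rightarrow> real" where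
  "diam K = diameter K"

text \<open>Minimal width: smallest distance between two parallel supporting hyperplanes,
  i.e. the infimum over unit directions u of the extent of K in direction u.\<close>
definition min_width :: "'a::euclidean_space set \<Rightarrow> real" where
  "min_width K = (INF u\<in>sphere 0 1. (SUP x\<in>K. u \<bullet> x) - (INF x\<in>K. u \<bullet> x))"

definition inradius :: "'a::euclidean_space set \<Rightarrow> real" where
  "inradius K = Sup {\<rho>. \<rho> \<ge> 0 \<and> (\<exists>c. cball c \<rho> \<subseteq> K)}"

definition circumradius :: "'a::euclidean_space set \<Rightarrow> real" where
  "circumradius K = Inf {\<rho>. \<rho> \<ge> 0 \<and> (\<exists>c. K \<subseteq> cball c \<rho>)}"

end

(*
  Let x, y be a diametral pair and write D = 2 R sin g with g in (0, pi/2].  A point c of K with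
  angle xcy < g would form with x, y an acute triangle of circumradius exceeding R, so every point
  of K sees the segment xy under an angle of at least g.  The bound reads w <= r (1 + t) with
  t = 1 / sin (g/2).

  Take an inball with centre o and contact normals u1, u2, u3 with o in the convex hull of the
  contact points.  If w > r (1 + t), then K contains for each i a point q_i at depth more than t r
  below o in direction u_i.  Its tangent wedge to the inball has an angle less than g, so x or y
  lies outside this wedge, i.e. it can be joined to q_i within K without meeting the inball.
  Deleting the inball from the region bounded by its three tangent lines separates the q_i, so x
  and y can each do this for at most one i; but there are three indices.
*)
theory Submission
  imports Defs
begin

section \<open>Circumradius and the angle subtended by a diameter\<close>

text \<open>The circumcentre of a non-obtuse triangle lies in the triangle. Averaged with its
  barycentric weights, the squared distances from \<open>z\<close> to the vertices give the squared
  circumradius plus the squared distance from \<open>z\<close> to the circumcentre, so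
  \<open>\<rho>\<close> is at least the circumradius, the product of the sides over four times the
  area. The bound is squared and cleared of denominators.\<close>

lemma acute_triangle_enclosing_ball:
  fixes x y c z :: "'a::real_inner"
  assumes ball: "norm (x - z) \<le> \<rho>" "norm (y - z) \<le> \<rho>" "norm (c - z) \<le> \<rho>"
    and longest: "norm (x - c) \<le> norm (x - y)" "norm (y - c) \<le> norm (x - y)"
    and acute: "(x - c) \<bullet> (y - c) \<ge> 0"
  shows "(norm (x - c) * norm (y - c) * norm (x - y))\<^sup>2
      \<le> 4 * ((norm (x - c) * norm (y - c))\<^sup>2 - ((x - c) \<bullet> (y - c))\<^sup>2) * \<rho>\<^sup>2"
proof -
  define X Y Z where "X = x - c" and "Y = y - c" and "Z = z - c"
  define A B g where "A = X \<bullet> X" and "B = Y \<bullet> Y" and "g = X \<bullet> Y"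
  have nA: "(norm X)\<^sup>2 = A" and nB: "(norm Y)\<^sup>2 = B" by (simp_all add: A_def B_def power2_norm_eq_inner)
  have xy: "x - y = X - Y" by (simp add: X_def Y_def)
  have D: "(norm (X - Y))\<^sup>2 = A + B - 2 * g"
    by (simp add: A_def B_def g_def power2_norm_eq_inner algebra_simps inner_commute)
  have A0: "A \<ge> 0" "B \<ge> 0" by (simp_all add: A_def B_def)
  have g0: "g \<ge> 0" using acute by (simp add: g_def X_def Y_def)
  have gA: "2 * g \<le> A" "2 * g \<le> B"
    using power_mono[OF longest(1), of 2] power_mono[OF longest(2), of 2] nA nB D
    by (simp_all add: X_def[symmetric] Y_def[symmetric] xy)
  \<comment> \<open>the weights are, up to a common factor, the barycentric coordinates of the circumcentre\<close>
  define mx my mc M where "mx = B * (A - g)" and "my = A * (B - g)"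
    and "mc = g * (A + B - 2 * g)" and "M = 2 * (A * B - g\<^sup>2)"
  have m0: "mx \<ge> 0" "my \<ge> 0" "mc \<ge> 0"
    using A0 g0 gA by (simp_all add: mx_def my_def mc_def)
  have M: "M = mc + mx + my"
    by (simp add: M_def mx_def my_def mc_def algebra_simps power2_eq_square)
  have M0: "M \<ge> 0" using m0 M by simp
  \<comment> \<open>\<open>W\<close> is \<open>M\<close> times the circumcentre seen from
    \<open>c\<close>; for nonzero \<open>M\<close>, \<open>WW\<close> gives the squared circumradius
    \<open>A * B * (A + B - 2 * g) / (2 * M)\<close>.\<close>
  define W where "W = mx *\<^sub>R X + my *\<^sub>R Y"
  have "W \<bullet> W = mx * mx * A + my * my * B + 2 * mx * my * g"
    by (simp add: W_def A_def B_def g_def algebra_simps inner_commute)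
  then have WW: "2 * (W \<bullet> W) = M * (A * B * (A + B - 2 * g))"
    by (simp add: mx_def my_def M_def algebra_simps power2_eq_square)
  have sq: "(norm (x - z))\<^sup>2 \<le> \<rho>\<^sup>2" "(norm (y - z))\<^sup>2 \<le> \<rho>\<^sup>2" "(norm (c - z))\<^sup>2 \<le> \<rho>\<^sup>2"
    using ball by (simp_all add: power_mono)
  have "M * \<rho>\<^sup>2 = mx * \<rho>\<^sup>2 + my * \<rho>\<^sup>2 + mc * \<rho>\<^sup>2" by (simp add: M algebra_simps)
  moreover have "mx * (norm (x - z))\<^sup>2 + my * (norm (y - z))\<^sup>2 + mc * (norm (c - z))\<^sup>2
      \<le> mx * \<rho>\<^sup>2 + my * \<rho>\<^sup>2 + mc * \<rho>\<^sup>2"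
    using sq m0 by (intro add_mono mult_left_mono)
  moreover have "mx * (norm (x - z))\<^sup>2 + my * (norm (y - z))\<^sup>2 + mc * (norm (c - z))\<^sup>2
      = M * (Z \<bullet> Z) + A * B * (A + B - 2 * g) - 2 * (W \<bullet> Z)"
  proof -
    have e: "x - z = X - Z" "y - z = Y - Z" "c - z = - Z" by (simp_all add: X_def Y_def Z_def)
    have "mx * A + my * B = A * B * (A + B - 2 * g)"
      by (simp add: mx_def my_def algebra_simps)
    moreover have "mx * (norm (x - z))\<^sup>2 + my * (norm (y - z))\<^sup>2 + mc * (norm (c - z))\<^sup>2
      = M * (Z \<bullet> Z) + (mx * A + my * B) - 2 * (W \<bullet> Z)"
      unfolding e M W_def A_def B_def
      by (simp add: power2_norm_eq_inner algebra_simps inner_commute)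
    ultimately show ?thesis by simp
  qed
  ultimately have "M * (Z \<bullet> Z) + A * B * (A + B - 2 * g) - 2 * (W \<bullet> Z) \<le> M * \<rho>\<^sup>2" by simp
  \<comment> \<open>Multiplying by \<open>M\<close> rather than dividing allows the square of
    \<open>M *\<^sub>R Z - W\<close> to be completed for degenerate triangles too.\<close>
  then have "M * (M * (Z \<bullet> Z) + A * B * (A + B - 2 * g) - 2 * (W \<bullet> Z)) \<le> M * (M * \<rho>\<^sup>2)"
    using M0 by (rule mult_left_mono)
  moreover have "M * (M * (Z \<bullet> Z) + A * B * (A + B - 2 * g) - 2 * (W \<bullet> Z))
      = (M *\<^sub>R Z - W) \<bullet> (M *\<^sub>R Z - W) + W \<bullet> W"
    using WW by (simp add: algebra_simps inner_commute)
  moreover have "(M *\<^sub>R Z - W) \<bullet> (M *\<^sub>R Z - W) \<ge> 0" by simp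
  ultimately have "W \<bullet> W \<le> M * (M * \<rho>\<^sup>2)" by linarith
  then have "M * (A * B * (A + B - 2 * g)) \<le> 2 * (M * (M * \<rho>\<^sup>2))" using WW by linarith
  then have le: "M * (A * B * (A + B - 2 * g)) \<le> M * (2 * M * \<rho>\<^sup>2)" by (simp only: mult_ac)
  have "A * B * (A + B - 2 * g) \<le> 2 * M * \<rho>\<^sup>2"
  \<comment> \<open>\<open>M = 0\<close> is equality in Cauchy-Schwarz; with
    \<open>4 * g\<^sup>2 \<le> A * B\<close> from \<open>gA\<close> it forces \<open>g = 0\<close>
    and \<open>A * B = 0\<close>.\<close>
  proof (cases "M = 0")
    case True
    then have "A * B = g * g" by (simp add: M_def power2_eq_square)
    moreover have "(2 * g) * (2 * g) \<le> A * B" using gA g0 by (intro mult_mono) auto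
    ultimately have "g * g \<le> 0" by simp
    then have "g = 0" by (auto simp: mult_le_0_iff)
    with \<open>A * B = g * g\<close> True show ?thesis by auto
  next
    case False
    with M0 have "M > 0" by simp
    with le show ?thesis by (rule mult_left_le_imp_le)
  qed
  then show ?thesis
    unfolding X_def[symmetric] Y_def[symmetric] xy g_def[symmetric]
    by (simp add: power_mult_distrib nA nB D M_def)
qed

text \<open>A bound valid for every enclosing radius passes to the infimum, so no smallest enclosing
  ball has to be exhibited. For \<open>M = 0\<close> a single enclosing ball yields
  \<open>N \<le> 0\<close>.\<close>

lemma circumradius_sq_ge:
  fixes K :: "'a::euclidean_space set"
  assumes "bounded K" "M \<ge> 0"
    and "\<And>z \<rho>. \<rho> \<ge> 0 \<Longrightarrow> K \<subseteq> cball z \<rho> \<Longrightarrow> N \<le> M * \<rho>\<^sup>2"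
  shows "N \<le> M * (circumradius K)\<^sup>2"
proof -
  let ?S = "{\<rho>. \<rho> \<ge> 0 \<and> (\<exists>c. K \<subseteq> cball c \<rho>)}"
  obtain e where "e > 0" "K \<subseteq> cball 0 e"
    using assms(1) unfolding bounded_pos by (auto simp: subset_eq)
  then have e: "e \<in> ?S" by auto
  show ?thesis
  proof (cases "M = 0 \<or> N \<le> 0")
    case True
    then show ?thesis
    proof
      assume "M = 0"
      then show ?thesis using e assms(3) by force
    next
      assume "N \<le> 0"
      then show ?thesis using assms(2) by (smt (verit) mult_nonneg_nonneg zero_le_power2)
    qed
  next
    case False
    then have pos: "M > 0" "N > 0" using assms(2) by auto
    have "sqrt (N / M) \<le> circumradius K"
      unfolding circumradius_def
    proof (rule cInf_greatest)
      show "?S \<noteq> {}" using e by blast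
      fix \<rho> assume "\<rho> \<in> ?S"
      then have "\<rho> \<ge> 0" "N \<le> M * \<rho>\<^sup>2" using assms(3) by auto
      then show "sqrt (N / M) \<le> \<rho>"
        using pos by (intro real_le_lsqrt) (auto simp: field_simps)
    qed
    then have "N / M \<le> (circumradius K)\<^sup>2"
      using pos by (metis sqrt_le_D)
    then show ?thesis using pos by (simp add: field_simps)
  qed
qed

lemma diameter_le_circumradius:
  fixes K :: "'a::euclidean_space set"
  assumes "bounded K" "K \<noteq> {}"
  shows "diameter K \<le> 2 * circumradius K"
proof -
  have "diameter K / 2 \<le> circumradius K"
    unfolding circumradius_def
  proof (rule cInf_greatest)
    show "{\<rho>. \<rho> \<ge> 0 \<and> (\<exists>c. K \<subseteq> cball c \<rho>)} \<noteq> {}"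
    proof -
      obtain e where "e > 0" "K \<subseteq> cball 0 e"
        using assms(1) unfolding bounded_pos by (auto simp: subset_eq)
      then show ?thesis using less_imp_le by blast
    qed
    fix \<rho> assume "\<rho> \<in> {\<rho>. \<rho> \<ge> 0 \<and> (\<exists>c. K \<subseteq> cball c \<rho>)}"
    then obtain z where "\<rho> \<ge> 0" "K \<subseteq> cball z \<rho>" by auto
    then have "diameter K \<le> diameter (cball z \<rho>)" by (intro diameter_subset) auto
    then show "diameter K / 2 \<le> \<rho>" using \<open>\<rho> \<ge> 0\<close> by (simp add: diameter_cball)
  qed
  then show ?thesis by simp
qed

text \<open>With D = 2 R sin g the square root is cos g, so the chord is seen from \<open>c\<close>
  under an angle of at least g. If the angle at \<open>c\<close> is at most \<pi>/2, this is the law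
  of sines in a triangle whose circumradius is at most that of \<open>K\<close>. The product form
  includes \<open>c = x\<close> and \<open>c = y\<close>.\<close>

lemma diametral_pair_angle:
  fixes K :: "'a::euclidean_space set"
  assumes "bounded K" and K: "x \<in> K" "y \<in> K" "c \<in> K"
    and D: "norm (x - y) = diameter K" "diameter K > 0"
  shows "(x - c) \<bullet> (y - c)
    \<le> sqrt (1 - (diameter K / (2 * circumradius K))\<^sup>2) * (norm (x - c) * norm (y - c))"
proof (cases "(x - c) \<bullet> (y - c) \<ge> 0")
  case True
  define P g d R where "P = norm (x - c) * norm (y - c)" and "g = (x - c) \<bullet> (y - c)"
    and "d = diameter K" and "R = circumradius K"
  have "d \<le> 2 * R"
    unfolding d_def R_def using assms(1) K(1) by (intro diameter_le_circumradius) auto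
  then have R: "R > 0" using D(2) by (simp add: d_def)
  have cs: "g\<^sup>2 \<le> P\<^sup>2"
    unfolding g_def P_def using True norm_cauchy_schwarz by (intro power_mono) auto
  have le: "norm (x - c) \<le> norm (x - y)" "norm (y - c) \<le> norm (x - y)"
    using diameter_bounded_bound[OF assms(1)] K D(1) by (auto simp: dist_norm)
  have "(P * d)\<^sup>2 \<le> 4 * (P\<^sup>2 - g\<^sup>2) * R\<^sup>2"
    unfolding R_def
  proof (rule circumradius_sq_ge[OF assms(1)])
    show "0 \<le> 4 * (P\<^sup>2 - g\<^sup>2)" using cs by simp
    fix z \<rho> assume "\<rho> \<ge> 0" "K \<subseteq> cball z \<rho>"
    then have "norm (x - z) \<le> \<rho>" "norm (y - z) \<le> \<rho>" "norm (c - z) \<le> \<rho>"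
      using K by (auto simp: dist_norm norm_minus_commute)
    from acute_triangle_enclosing_ball[OF this le True]
    show "(P * d)\<^sup>2 \<le> 4 * (P\<^sup>2 - g\<^sup>2) * \<rho>\<^sup>2" by (simp add: P_def g_def d_def D(1))
  qed
  then have "g\<^sup>2 \<le> (1 - (d / (2 * R))\<^sup>2) * P\<^sup>2"
    using R by (simp add: field_simps power_mult_distrib)
  then have "sqrt (g\<^sup>2) \<le> sqrt ((1 - (d / (2 * R))\<^sup>2) * P\<^sup>2)" by (rule real_sqrt_le_mono)
  then show ?thesis using True
    by (simp add: real_sqrt_mult P_def g_def d_def R_def)
next
  case False
  have "diameter K \<le> 2 * circumradius K"
    using assms(1) K(1) by (intro diameter_le_circumradius) auto
  then have "diameter K / (2 * circumradius K) \<le> 1" "diameter K / (2 * circumradius K) \<ge> 0"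
    using D(2) by (auto simp: divide_le_eq)
  then have "0 \<le> sqrt (1 - (diameter K / (2 * circumradius K))\<^sup>2)"
    by (simp add: power_le_one)
  then show ?thesis using False by (smt (verit) mult_nonneg_nonneg norm_ge_zero)
qed

section \<open>Width and points far below the centre\<close>

text \<open>The extent of \<open>K\<close> in direction \<open>u\<close> is at least the minimal
  width; as at most \<open>r\<close> of it lies above \<open>c\<close>, more than \<open>s\<close>
  lies below.\<close>

lemma support_deep_point:
  fixes K :: "'a::euclidean_space set"
  assumes "bounded K" "K \<noteq> {}" "norm u = 1"
    and top: "\<And>x. x \<in> K \<Longrightarrow> u \<bullet> (x - c) \<le> r"
    and w: "min_width K > r + s"
  obtains q where "q \<in> K" "u \<bullet> (q - c) < - s"
proof (cases "\<exists>q\<in>K. u \<bullet> (q - c) < - s")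
  case True
  then show ?thesis using that by blast
next
  case False
  then have low: "u \<bullet> x \<ge> u \<bullet> c - s" if "x \<in> K" for x
    using that by (force simp: inner_diff_right)
  have bdd: "bdd_above ((\<bullet>) v ` K)" "bdd_below ((\<bullet>) v ` K)" for v
    using bounded_linear_image[OF assms(1) bounded_linear_inner_right]
    by (auto intro: bounded_imp_bdd_above bounded_imp_bdd_below)
  obtain z where z: "z \<in> K" using assms(2) by blast
  have "min_width K \<le> (SUP x\<in>K. u \<bullet> x) - (INF x\<in>K. u \<bullet> x)"
    unfolding min_width_def
  proof (rule cINF_lower)
    show "u \<in> sphere 0 1" using assms(3) by simp
    show "bdd_below ((\<lambda>u. (SUP x\<in>K. u \<bullet> x) - (INF x\<in>K. u \<bullet> x)) ` sphere 0 1)"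
    proof (rule bdd_belowI2[of _ 0])
      fix v :: 'a
      have "(INF x\<in>K. v \<bullet> x) \<le> v \<bullet> z" using bdd z by (intro cINF_lower) auto
      also have "\<dots> \<le> (SUP x\<in>K. v \<bullet> x)" using bdd z by (intro cSUP_upper) auto
      finally show "0 \<le> (SUP x\<in>K. v \<bullet> x) - (INF x\<in>K. v \<bullet> x)" by simp
    qed
  qed
  moreover have "(SUP x\<in>K. u \<bullet> x) \<le> u \<bullet> c + r"
    using assms(2) top by (intro cSUP_least) (auto simp: inner_diff_right algebra_simps)
  moreover have "(INF x\<in>K. u \<bullet> x) \<ge> u \<bullet> c - s"
    using assms(2) low by (intro cINF_greatest) auto
  ultimately show ?thesis using w by simp
qed

section \<open>The largest inscribed ball and its contact normals\<close>

text \<open>The centre maximises the distance to the frontier. Were it outside the hull of the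
  contact points, a line would separate it from them, and a small shift away from them would make
  room for a larger ball.\<close>

lemma convex_body_inball:
  fixes K :: "'a::euclidean_space set"
  assumes "convex_body K"
  obtains c r where "r > 0" "cball c r \<subseteq> K" "inradius K = r"
    "c \<in> convex hull (frontier K \<inter> sphere c r)"
proof -
  have cvx: "convex K" and cpt: "compact K" and int: "interior K \<noteq> {}"
    using assms by (auto simp: convex_body_def)
  have ne: "K \<noteq> {}" using int by auto
  have "K \<noteq> UNIV" using cpt compact_imp_bounded not_bounded_UNIV by metis
  then have fne: "frontier K \<noteq> {}" using ne by (simp add: frontier_eq_empty)
  have fcpt: "compact (frontier K)" using cpt by (rule compact_frontier)
  \<comment> \<open>For \<open>y\<close> in \<open>K\<close> this is the radius of the largest ball
    about \<open>y\<close> inside \<open>K\<close>; continuity and compactness provide a best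
    centre.\<close>
  define f where "f c = infdist c (frontier K)" for c
  have "continuous_on K f" unfolding f_def by (intro continuous_intros)
  then obtain c where c: "c \<in> K" "\<And>y. y \<in> K \<Longrightarrow> f y \<le> f c"
    using continuous_attains_sup[OF cpt ne] by metis
  have f_sub: "cball y (f y) \<subseteq> K" if "y \<in> K" for y
  proof (cases "f y > 0")
    case True
    have "ball y (f y) \<subseteq> K"
    proof (rule ccontr)
      assume "\<not> ?thesis"
      then have "ball y (f y) \<inter> frontier K \<noteq> {}"
        using True that centre_in_ball[of y "f y"] by (intro connected_Int_frontier) blast+
      then obtain p where "p \<in> frontier K" "dist y p < f y" by auto
      then show False using infdist_le[of p "frontier K" y] by (simp add: f_def)
    qed
    then have "closure (ball y (f y)) \<subseteq> K"
      using cpt by (intro closure_minimal compact_imp_closed)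
    then show ?thesis using True by simp
  next
    case False
    then have "f y = 0" using infdist_nonneg[of y "frontier K"] by (simp add: f_def)
    then show ?thesis using that by simp
  qed
  have f_ge: "\<rho> \<le> f c" if "cball y \<rho> \<subseteq> K" for y \<rho>
  proof (cases "\<rho> \<ge> 0")
    case True
    have y: "y \<in> K" using that True by auto
    have "ball y \<rho> \<subseteq> interior K"
      using that by (intro interior_maximal) auto
    then have "\<rho> \<le> dist y p" if "p \<in> frontier K" for p
      using that by (force simp: frontier_def)
    then have "\<rho> \<le> f y"
      unfolding f_def infdist_notempty[OF fne] using fne by (intro cINF_greatest) auto
    also have "\<dots> \<le> f c" using y by (rule c(2))
    finally show ?thesis .
  next
    case False
    then show ?thesis using infdist_nonneg[of c "frontier K"] by (simp add: f_def)
  qed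
  obtain z e where "e > 0" "cball z e \<subseteq> K"
    using int by (metis ex_in_conv mem_interior_cball)
  then have r0: "f c > 0" using f_ge by fastforce
  have inr: "inradius K = f c"
    unfolding inradius_def
    using r0 f_sub[OF c(1)] f_ge by (intro cSup_eq_maximum) auto
  define N where "N = frontier K \<inter> sphere c (f c)"
  have "compact N" unfolding N_def using fcpt by (intro compact_Int) auto
  have "c \<in> convex hull N"
  proof (rule ccontr)
    assume "\<not> ?thesis"
    then obtain a b where ab: "a \<bullet> c < b" "\<And>x. x \<in> convex hull N \<Longrightarrow> b < a \<bullet> x"
      using separating_hyperplane_closed_point[of "convex hull N" c] \<open>compact N\<close>
      by (metis compact_convex_hull compact_imp_closed convex_convex_hull)
    then have aN: "a \<bullet> (p - c) > 0" if "p \<in> N" for p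
      using that hull_subset[of N convex] by (force simp: inner_diff_right)
    \<comment> \<open>Every contact point satisfies \<open>a \<bullet> (p - c) > 0\<close>, so the
      compact set \<open>A\<close> avoids the inball and keeps a positive gap \<open>\<eta>\<close>
      from it.\<close>
    define A where "A = frontier K \<inter> {p. a \<bullet> (p - c) \<le> 0}"
    have Acpt: "compact A"
      unfolding A_def inner_diff_right using fcpt
      by (intro compact_Int_closed closed_Collect_le continuous_intros)
    obtain \<eta> where eta: "\<eta> > 0" "\<And>p. p \<in> A \<Longrightarrow> dist c p \<ge> f c + \<eta>"
    proof (cases "A = {}")
      case True
      then show ?thesis using that[of 1] by auto
    next
      case False
      obtain p where p: "p \<in> A" "\<And>q. q \<in> A \<Longrightarrow> dist c p \<le> dist c q"
        using continuous_attains_inf[OF Acpt False continuous_on_dist[OF continuous_on_const continuous_on_id], of c]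
        by auto
      have "dist c p \<ge> f c" using p(1) infdist_le by (auto simp: A_def f_def)
      moreover have "dist c p \<noteq> f c" using p(1) aN[of p] by (auto simp: A_def N_def)
      ultimately show ?thesis using p(2) that[of "dist c p - f c"] by auto
    qed
    show False
    \<comment> \<open>A zero normal can only arise when there is no contact point; then the whole
      frontier is farther away than \<open>f c\<close>.\<close>
    proof (cases "a = 0")
      case True
      then have "A = frontier K" by (simp add: A_def)
      then have "f c + \<eta> \<le> f c"
        unfolding f_def infdist_notempty[OF fne] using fne eta(2)
        by (intro cINF_greatest) (auto simp: f_def infdist_notempty[OF fne])
      then show False using eta(1) by simp
    next
      case False
      \<comment> \<open>moving the centre away from all contact points enlarges the ball\<close>
      define \<epsilon> where "\<epsilon> = min (f c) (\<eta> / 2)"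
      have eps: "\<epsilon> > 0" "\<epsilon> \<le> f c" "\<epsilon> \<le> \<eta> / 2" using r0 eta(1) by (auto simp: \<epsilon>_def)
      define y where "y = c - (\<epsilon> / norm a) *\<^sub>R a"
      have dcy: "dist c y = \<epsilon>" using eps(1) False by (simp add: y_def dist_norm)
      have "y \<in> K" using f_sub[OF c(1)] dcy eps by auto
      \<comment> \<open>The first term bounds the distance from \<open>y\<close> to
        \<open>A\<close>: the gap \<open>\<eta>\<close> minus a shift of at most
        \<open>\<eta> / 2\<close>. The second bounds the distance to the other frontier points,
        where the cross term of the expanded square is positive. Both exceed
        \<open>f c\<close>.\<close>
      define r' where "r' = min (f c + \<eta> / 2) (sqrt ((f c)\<^sup>2 + \<epsilon>\<^sup>2))"
      have "r' \<le> dist y p" if p: "p \<in> frontier K" for p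
      proof (cases "p \<in> A")
        case True
        have "f c + \<eta> \<le> dist c y + dist y p"
          using eta(2)[OF True] dist_triangle[of c p y] by linarith
        then show ?thesis using dcy eps by (simp add: r'_def)
      next
        case False
        then have ap: "a \<bullet> (p - c) > 0" using p by (simp add: A_def)
        have fp: "f c \<le> norm (p - c)"
          using infdist_le[OF p, of c] by (simp add: f_def dist_norm norm_minus_commute)
        have "(f c)\<^sup>2 + \<epsilon>\<^sup>2 \<le> (norm (p - c))\<^sup>2 + \<epsilon>\<^sup>2"
          using fp r0 by simp
        also have "\<dots> \<le> (norm (p - c))\<^sup>2 + 2 * (\<epsilon> / norm a) * (a \<bullet> (p - c)) + \<epsilon>\<^sup>2"
          using ap eps by simp
        also have "\<dots> = (norm ((p - c) + (\<epsilon> / norm a) *\<^sub>R a))\<^sup>2"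
          using \<open>a \<noteq> 0\<close> eps
          by (simp add: dot_norm[symmetric] power2_norm_eq_inner inner_add_left inner_add_right inner_commute)
             (simp add: power2_norm_eq_inner[symmetric] field_simps power2_eq_square inner_commute)
        also have "(p - c) + (\<epsilon> / norm a) *\<^sub>R a = p - y" by (simp add: y_def)
        finally have "sqrt ((f c)\<^sup>2 + \<epsilon>\<^sup>2) \<le> dist y p"
          by (simp add: real_le_lsqrt dist_norm norm_minus_commute)
        then show ?thesis by (simp add: r'_def)
      qed
      then have "r' \<le> f y"
        unfolding f_def infdist_notempty[OF fne] using fne by (intro cINF_greatest) auto
      moreover have "f c < r'"
        using eta(1) eps by (simp add: r'_def real_less_rsqrt)
      ultimately show False using c(2)[OF \<open>y \<in> K\<close>] by simp
    qed
  qed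
  then show ?thesis using that[of "f c" c] r0 f_sub[OF c(1)] inr by (simp add: N_def)
qed

text \<open>A line supporting \<open>K\<close> at \<open>p\<close> also supports the ball inside
  \<open>K\<close>, hence is the tangent of the ball at \<open>p\<close>, with normal
  \<open>p - c\<close>.\<close>

lemma contact_point_supporting:
  fixes K :: "'a::euclidean_space set"
  assumes "convex K" "r > 0" "cball c r \<subseteq> K" "p \<in> frontier K" "p \<in> sphere c r"
    and x: "x \<in> K"
  shows "(p - c) \<bullet> (x - c) \<le> r\<^sup>2"
proof -
  have "interior K \<noteq> {}"
    using assms(2,3) by (metis interior_mono interior_cball ball_eq_empty subset_empty not_le)
  then have "rel_interior K = interior K" by (rule rel_interior_nonempty_interior)
  then obtain a where a: "a \<noteq> 0" "\<And>y. y \<in> closure K \<Longrightarrow> a \<bullet> p \<le> a \<bullet> y"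
    using supporting_hyperplane_relative_frontier[OF assms(1), of p] assms(4)
    by (metis DiffE frontier_def)
  have np: "norm (p - c) = r" using assms(5) by (simp add: dist_norm norm_minus_commute)
  \<comment> \<open>The point of the ball lowest in direction \<open>a\<close>; comparing it with
    \<open>p\<close> gives equality in Cauchy-Schwarz.\<close>
  let ?z = "c - (r / norm a) *\<^sub>R a"
  have "?z \<in> K" using assms(2,3) a(1) by (auto simp: dist_norm)
  then have "a \<bullet> p \<le> a \<bullet> ?z" using a(2) closure_subset by blast
  then have "norm a * norm (c - p) \<le> a \<bullet> (c - p)"
    using a(1) np by (simp add: inner_diff_right norm_minus_commute power2_norm_eq_inner[symmetric] power2_eq_square)
       (simp add: dot_square_norm power2_eq_square algebra_simps)
  then have "a \<bullet> (c - p) = norm a * norm (c - p)"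
    using norm_cauchy_schwarz[of a "c - p"] by linarith
  then have "norm a *\<^sub>R (c - p) = r *\<^sub>R a"
    using np by (simp add: norm_cauchy_schwarz_eq norm_minus_commute)
  then have "r *\<^sub>R a = norm a *\<^sub>R (c - p)" by simp
  moreover have "a \<bullet> p \<le> a \<bullet> x" using a(2) x closure_subset by blast
  then have "r * (a \<bullet> p) \<le> r * (a \<bullet> x)" using assms(2) by (intro mult_left_mono) auto
  ultimately have "norm a * ((c - p) \<bullet> p) \<le> norm a * ((c - p) \<bullet> x)"
    by (metis inner_scaleR_left)
  then have "(c - p) \<bullet> p \<le> (c - p) \<bullet> x" using a(1) by simp
  then have "(p - c) \<bullet> (x - c) \<le> (p - c) \<bullet> (p - c)"
    by (simp add: algebra_simps)
  then show ?thesis using np by (simp add: power2_norm_eq_inner[symmetric])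
qed

text \<open>Caratheodory's theorem in the plane leaves at most three contact points with the centre
  in their hull; their directions from the centre inherit the weights. Fewer points are padded by
  repetition, so the normals may coincide.\<close>

lemma convex_body_contact_normals:
  fixes K :: "(real^2) set"
  assumes "convex_body K"
  obtains c r u1 u2 u3 l1 l2 l3 where "r > 0" "cball c r \<subseteq> K" "inradius K = r"
    "norm u1 = 1" "norm u2 = 1" "norm u3 = 1"
    "l1 \<ge> 0" "l2 \<ge> 0" "l3 \<ge> 0" "l1 + l2 + l3 = 1" "l1 *\<^sub>R u1 + l2 *\<^sub>R u2 + l3 *\<^sub>R u3 = 0"
    "\<And>x. x \<in> K \<Longrightarrow> u1 \<bullet> (x - c) \<le> r" "\<And>x. x \<in> K \<Longrightarrow> u2 \<bullet> (x - c) \<le> r"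
    "\<And>x. x \<in> K \<Longrightarrow> u3 \<bullet> (x - c) \<le> r"
proof -
  obtain c r where cr: "r > 0" "cball c r \<subseteq> K" "inradius K = r"
    "c \<in> convex hull (frontier K \<inter> sphere c r)" using convex_body_inball[OF assms] .
  obtain S where S: "finite S" "S \<subseteq> frontier K \<inter> sphere c r" "card S \<le> 3" "c \<in> convex hull S"
    using cr(4) unfolding caratheodory[of "frontier K \<inter> sphere c r"] by auto
  have "S \<noteq> {}" using S(4) by auto
  have "\<exists>p1 p2 p3. S = {p1, p2, p3}"
  proof -
    have "card S = 1 \<or> card S = 2 \<or> card S = 3"
      using S(1,3) \<open>S \<noteq> {}\<close> card_gt_0_iff[of S] by linarith
    then show ?thesis by (metis card_1_singletonE card_2_iff card_3_iff insert_absorb2)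
  qed
  then obtain p1 p2 p3 where p: "S = {p1, p2, p3}" by auto
  obtain l1 l2 l3 where l: "l1 \<ge> 0" "l2 \<ge> 0" "l3 \<ge> 0" "l1 + l2 + l3 = 1"
      "c = l1 *\<^sub>R p1 + l2 *\<^sub>R p2 + l3 *\<^sub>R p3"
    using S(4) unfolding p convex_hull_3 by auto
  define u where "u p = (p - c) /\<^sub>R r" for p
  have nu: "norm (u p) = 1" if "p \<in> S" for p
    using that S(2) cr(1) by (auto simp: u_def dist_norm norm_minus_commute)
  have ux: "u p \<bullet> (x - c) \<le> r" if "p \<in> S" "x \<in> K" for p x
  proof -
    have "(p - c) \<bullet> (x - c) \<le> r * r"
      unfolding power2_eq_square[symmetric]
    proof (rule contact_point_supporting[OF _ cr(1,2)])
      show "convex K" using assms by (simp add: convex_body_def)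
    qed (use that S(2) in auto)
    then show ?thesis using cr(1) by (simp add: u_def divide_inverse_commute[symmetric] pos_divide_le_eq)
  qed
  have "l1 *\<^sub>R (p1 - c) + l2 *\<^sub>R (p2 - c) + l3 *\<^sub>R (p3 - c) = c - (l1 + l2 + l3) *\<^sub>R c"
    by (subst (4) l(5)) (simp add: algebra_simps)
  then have "l1 *\<^sub>R (p1 - c) + l2 *\<^sub>R (p2 - c) + l3 *\<^sub>R (p3 - c) = 0" by (simp add: l(4))
  moreover have "l1 *\<^sub>R u p1 + l2 *\<^sub>R u p2 + l3 *\<^sub>R u p3
      = (1 / r) *\<^sub>R (l1 *\<^sub>R (p1 - c) + l2 *\<^sub>R (p2 - c) + l3 *\<^sub>R (p3 - c))"
    by (simp add: u_def scaleR_add_right divide_inverse_commute mult.commute)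
  ultimately have "l1 *\<^sub>R u p1 + l2 *\<^sub>R u p2 + l3 *\<^sub>R u p3 = 0" by simp
  then show ?thesis
    using that[OF cr(1-3) nu[of p1] nu[of p2] nu[of p3] l(1-4)] ux p by simp
qed

section \<open>Angles in the tangent wedge of a deep point\<close>

text \<open>Put \<open>\<rho>\<close> = sin \<alpha> and \<open>\<sigma>\<close> = cos \<alpha>.
  Both vectors lie within \<alpha> of the positive first axis, so they enclose at most 2\<alpha>,
  and \<open>2 * \<rho>\<^sup>2 < 1 - \<kappa>\<close> says \<open>\<kappa>\<close> < cos
  2\<alpha>.\<close>

lemma inner_gt_within_wedge:
  fixes \<rho> \<sigma> \<kappa> \<xi> \<eta> \<xi>' \<eta>' :: real
  assumes "\<rho> > 0" "\<sigma> > 0" "\<rho>\<^sup>2 + \<sigma>\<^sup>2 = 1" "2 * \<rho>\<^sup>2 < 1 - \<kappa>" "\<kappa> \<ge> 0"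
    and "\<sigma> * \<bar>\<eta>\<bar> \<le> \<rho> * \<xi>" "\<sigma> * \<bar>\<eta>'\<bar> \<le> \<rho> * \<xi>'"
    and "\<xi>\<^sup>2 + \<eta>\<^sup>2 > 0" "\<xi>'\<^sup>2 + \<eta>'\<^sup>2 > 0"
  shows "\<kappa> * (sqrt (\<xi>\<^sup>2 + \<eta>\<^sup>2) * sqrt (\<xi>'\<^sup>2 + \<eta>'\<^sup>2)) < \<xi> * \<xi>' + \<eta> * \<eta>'"
proof -
  have pos: "a > 0" and len: "\<sigma> * sqrt (a\<^sup>2 + b\<^sup>2) \<le> a"
    if h: "\<sigma> * \<bar>b\<bar> \<le> \<rho> * a" and nz: "a\<^sup>2 + b\<^sup>2 > 0" for a b
  proof -
    have "0 \<le> \<rho> * a" using h assms(2) by (smt (verit) mult_nonneg_nonneg abs_ge_zero)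
    then have a0: "a \<ge> 0" using assms(1) by (simp add: zero_le_mult_iff)
    have "a \<noteq> 0"
    proof
      assume "a = 0"
      then have "\<sigma> * \<bar>b\<bar> \<le> 0" using h by simp
      then have "b = 0" using assms(2) by (simp add: mult_le_0_iff)
      with \<open>a = 0\<close> nz show False by simp
    qed
    with a0 show "a > 0" by simp
    have "(\<sigma> * \<bar>b\<bar>)\<^sup>2 \<le> (\<rho> * a)\<^sup>2" using h assms(2) by (intro power_mono) auto
    then have "\<sigma>\<^sup>2 * b\<^sup>2 \<le> \<rho>\<^sup>2 * a\<^sup>2" by (simp add: power_mult_distrib)
    moreover have "a\<^sup>2 = \<rho>\<^sup>2 * a\<^sup>2 + \<sigma>\<^sup>2 * a\<^sup>2"
      by (metis assms(3) distrib_right mult_1)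
    ultimately have "(\<sigma> * sqrt (a\<^sup>2 + b\<^sup>2))\<^sup>2 \<le> a\<^sup>2"
      by (simp add: power_mult_distrib distrib_left)
    then show "\<sigma> * sqrt (a\<^sup>2 + b\<^sup>2) \<le> a" using a0 by (rule power2_le_imp_le)
  qed
  note p = pos[OF assms(6,8)] pos[OF assms(7,9)]
  have "(\<sigma> * sqrt (\<xi>\<^sup>2 + \<eta>\<^sup>2)) * (\<sigma> * sqrt (\<xi>'\<^sup>2 + \<eta>'\<^sup>2)) \<le> \<xi> * \<xi>'"
    using len[OF assms(6,8)] len[OF assms(7,9)] p assms(2) by (intro mult_mono) auto
  then have "\<kappa> * ((\<sigma> * sqrt (\<xi>\<^sup>2 + \<eta>\<^sup>2)) * (\<sigma> * sqrt (\<xi>'\<^sup>2 + \<eta>'\<^sup>2))) \<le> \<kappa> * (\<xi> * \<xi>')"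
    using assms(5) by (rule mult_left_mono)
  also have "\<dots> < (1 - 2 * \<rho>\<^sup>2) * (\<xi> * \<xi>')"
    using p assms(4) by (intro mult_strict_right_mono) auto
  also have "\<dots> = (\<sigma>\<^sup>2 - \<rho>\<^sup>2) * (\<xi> * \<xi>')" proof -
    have "1 - 2 * \<rho>\<^sup>2 = \<sigma>\<^sup>2 - \<rho>\<^sup>2" using assms(3) by simp
    then show ?thesis by simp
  qed
  \<comment> \<open>The worst case puts the vectors on opposite edges of the wedge; the product of
    the two wedge inequalities bounds the negative part of \<open>\<eta> * \<eta>'\<close>.\<close>
  also have "\<dots> \<le> \<sigma>\<^sup>2 * (\<xi> * \<xi>' + \<eta> * \<eta>')"
  proof -
    have "(\<sigma> * \<bar>\<eta>\<bar>) * (\<sigma> * \<bar>\<eta>'\<bar>) \<le> (\<rho> * \<xi>) * (\<rho> * \<xi>')"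
      using assms(1,2,7) p by (intro mult_mono[OF assms(6,7)]) auto
    moreover have "- (\<eta> * \<eta>') \<le> \<bar>\<eta>\<bar> * \<bar>\<eta>'\<bar>" by (metis abs_ge_minus_self abs_mult)
    then have "\<sigma>\<^sup>2 * (- (\<eta> * \<eta>')) \<le> \<sigma>\<^sup>2 * (\<bar>\<eta>\<bar> * \<bar>\<eta>'\<bar>)" by (rule mult_left_mono) simp
    ultimately show ?thesis by (simp add: algebra_simps power2_eq_square)
  qed
  finally have "\<sigma>\<^sup>2 * (\<kappa> * (sqrt (\<xi>\<^sup>2 + \<eta>\<^sup>2) * sqrt (\<xi>'\<^sup>2 + \<eta>'\<^sup>2))) < \<sigma>\<^sup>2 * (\<xi> * \<xi>' + \<eta> * \<eta>')"
    by (simp add: power2_eq_square mult_ac)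
  then show ?thesis using assms(2) by (simp add: mult_less_cancel_left)
qed

text \<open>The ball is centred at the origin, and \<open>v\<close> is the normal of a tangent line
  with \<open>q\<close> on or beyond it and \<open>x\<close> or \<open>y\<close> strictly beyond.
  Without such a line, \<open>x\<close> and \<open>y\<close> lie in the wedge at \<open>q\<close>
  bounded by its two tangents, whose half-angle has sine \<open>r / norm q\<close>, less than 1/t.
  For \<open>\<kappa>\<close> = cos g the equation for \<open>t\<close> reads t = 1 / sin (g/2), so
  the wedge is narrower than g.\<close>

lemma tangent_escape:
  fixes q x y :: "real^2"
  assumes "r > 0" "\<kappa> \<ge> 0" "t \<ge> 0" "t\<^sup>2 * (1 - \<kappa>) = 2" "norm q > t * r"
    and angle: "(x - q) \<bullet> (y - q) \<le> \<kappa> * (norm (x - q) * norm (y - q))"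
  shows "\<exists>v. norm v = 1 \<and> v \<bullet> q \<ge> r \<and> (v \<bullet> x > r \<or> v \<bullet> y > r)"
proof (rule ccontr)
  assume neg: "\<not> ?thesis"
  have k1: "\<kappa> < 1" using assms(4) by (smt (verit) mult_nonneg_nonpos zero_le_power2)
  have t2: "t\<^sup>2 > 1" 
    by (smt (verit, best) assms(2,4) mult_left_le zero_le_power2)
  then have t1: "t > 1" using assms(3) by (simp add: power2_eq_square) (smt (verit) mult_le_one)
  have qr: "norm q > r" using assms(1,5) t1 by (smt (verit) mult_less_cancel_right2)
  then have q0: "q \<noteq> 0" using assms(1) by auto
  define e where "e = q /\<^sub>R norm q"
  have ne: "norm e = 1" using q0 by (simp add: e_def)
  have eq: "e \<bullet> q = norm q" using q0 by (simp add: e_def power2_norm_eq_inner[symmetric] power2_eq_square)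
  \<comment> \<open>If \<open>x\<close> or \<open>y\<close> were \<open>q\<close>, then
    \<open>v = e\<close> would do.\<close>
  have xq: "x \<noteq> q" "y \<noteq> q" using neg ne eq qr by (metis less_eq_real_def)+
  define f :: "real^2" where "f = vector [- e$2, e$1]"
  have ee: "(e$1)\<^sup>2 + (e$2)\<^sup>2 = 1"
    using ne by (simp add: norm_eq_sqrt_inner inner_vec_def sum_2 power2_eq_square)
  have ff: "norm f = 1" "e \<bullet> f = 0"
    using ne by (simp_all add: f_def norm_eq_sqrt_inner inner_vec_def sum_2 add.commute)
  have fq: "f \<bullet> q = 0" using ff(2) q0 by (simp add: e_def inner_commute)
  define \<rho> where "\<rho> = r / norm q"
  define \<sigma> where "\<sigma> = sqrt (1 - \<rho>\<^sup>2)"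
  have rho: "\<rho> > 0" "\<rho> < 1" using assms(1) q0 qr by (auto simp: \<rho>_def)
  have sig: "\<sigma> > 0" "\<rho>\<^sup>2 + \<sigma>\<^sup>2 = 1"
    using rho abs_square_less_1[of \<rho>] by (auto simp: \<sigma>_def)
  have rt: "2 * \<rho>\<^sup>2 < 1 - \<kappa>"
  proof -
    have "t * \<rho> < 1" using assms(5) q0 by (simp add: \<rho>_def field_simps)
    then have "(t * \<rho>)\<^sup>2 < 1" using t1 rho by (simp add: abs_square_less_1 abs_mult)
    then have "(t * \<rho>)\<^sup>2 * (1 - \<kappa>) < 1 * (1 - \<kappa>)" using k1 by (intro mult_strict_right_mono) auto
    moreover have "(t * \<rho>)\<^sup>2 * (1 - \<kappa>) = \<rho>\<^sup>2 * (t\<^sup>2 * (1 - \<kappa>))" by (simp add: power_mult_distrib)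
    ultimately show ?thesis unfolding assms(4) by simp
  qed
  have wedge: "\<sigma> * \<bar>f \<bullet> (z - q)\<bar> \<le> \<rho> * (- (e \<bullet> (z - q)))" if "z = x \<or> z = y" for z
  proof -
    have "c * (f \<bullet> (z - q)) \<le> \<rho> * (- (e \<bullet> (z - q)))" if "c = \<sigma> \<or> c = - \<sigma>" for c
    proof -
      \<comment> \<open>For \<open>c\<close> equal to \<open>\<sigma>\<close> or
        \<open>- \<sigma>\<close> these are the unit normals of the two tangents through
        \<open>q\<close>; each yields one edge of the wedge.\<close>
      let ?v = "\<rho> *\<^sub>R e + c *\<^sub>R f"
      have "?v \<bullet> ?v = \<rho>\<^sup>2 * (e \<bullet> e) + c\<^sup>2 * (f \<bullet> f) + 2 * \<rho> * c * (e \<bullet> f)"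
        by (simp add: algebra_simps inner_commute power2_eq_square)
      also have "\<dots> = 1" using ne ff sig that by (auto simp: norm_eq_1)
      finally have nv: "norm ?v = 1" by (simp add: norm_eq_1)
      have vq: "?v \<bullet> q = r" using eq fq q0 by (simp add: inner_add_left \<rho>_def)
      then have "?v \<bullet> z \<le> r" using neg nv \<open>z = x \<or> z = y\<close> by (metis not_le order_refl)
      then have "?v \<bullet> (z - q) \<le> 0" using vq by (simp add: inner_diff_right)
      then show ?thesis by (simp add: inner_add_left)
    qed
    from this[of \<sigma>] this[of "- \<sigma>"] show ?thesis by (simp add: abs_if)
  qed
  \<comment> \<open>Coordinates in the orthonormal frame of \<open>- e\<close> and \<open>f\<close>;
    the wedge opens from \<open>q\<close> towards the centre, so \<open>- e\<close> is its
    axis.\<close>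
  have ip: "a \<bullet> b = (- (e \<bullet> a)) * (- (e \<bullet> b)) + (f \<bullet> a) * (f \<bullet> b)" for a b :: "real^2"
  proof -
    have "(- (e \<bullet> a)) * (- (e \<bullet> b)) + (f \<bullet> a) * (f \<bullet> b) = ((e$1)\<^sup>2 + (e$2)\<^sup>2) * (a \<bullet> b)"
      by (simp add: f_def inner_vec_def sum_2 algebra_simps power2_eq_square)
    then show ?thesis using ee by simp
  qed
  have nm: "norm a = sqrt ((- (e \<bullet> a))\<^sup>2 + (f \<bullet> a)\<^sup>2)" for a :: "real^2"
    using ip[of a a] by (simp add: norm_eq_sqrt_inner power2_eq_square)
  have nz: "(- (e \<bullet> a))\<^sup>2 + (f \<bullet> a)\<^sup>2 > 0" if "a \<noteq> 0" for a :: "real^2"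
    using that nm[of a] by (metis norm_eq_zero real_sqrt_gt_0_iff zero_less_norm_iff)
  have "\<kappa> * (norm (x - q) * norm (y - q)) < (x - q) \<bullet> (y - q)"
    unfolding nm ip[of "x - q" "y - q"]
    using wedge xq by (intro inner_gt_within_wedge[OF rho(1) sig rt assms(2)] nz) auto
  with angle show False by simp
qed

section \<open>Cones of contact normals and separation by the inball\<close>

text \<open>If \<open>u1\<close> occurred in \<open>v\<close>, at most one other normal would, with
  coefficient b. The low value of \<open>u1 \<bullet> q\<close> forces b > 1 + \<open>c1\<close>,
  the triangle inequality b \<le> 1 + \<open>c1\<close>. Thus a tangent line cutting off a deep
  point has its normal in the cone of the other two contact normals.\<close>

lemma cone_coefficient_zero:
  fixes u1 u2 u3 v q :: "'a::real_inner"
  assumes unit: "norm u1 = 1" "norm u2 = 1" "norm u3 = 1" "norm v = 1" and "r > 0"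
    and c: "c1 \<ge> 0" "c2 \<ge> 0" "c3 \<ge> 0" "c1 = 0 \<or> c2 = 0 \<or> c3 = 0"
    and v: "v = c1 *\<^sub>R u1 + c2 *\<^sub>R u2 + c3 *\<^sub>R u3"
    and q: "u1 \<bullet> q < - r" "u2 \<bullet> q \<le> r" "u3 \<bullet> q \<le> r" "v \<bullet> q \<ge> r"
  shows "c1 = 0"
proof (rule ccontr)
  assume "c1 \<noteq> 0"
  then have c1: "c1 > 0" using c(1) by simp
  have main: False if b: "b \<ge> 0" and w: "norm w = 1" "w \<bullet> q \<le> r" and vw: "v = c1 *\<^sub>R u1 + b *\<^sub>R w" for b w
  proof -
    have "r \<le> c1 * (u1 \<bullet> q) + b * (w \<bullet> q)" using q(4) by (simp add: vw inner_add_left)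
    also have "\<dots> < c1 * (- r) + b * r"
      using c1 q(1) b w(2) by (intro add_less_le_mono mult_strict_left_mono mult_left_mono) auto
    also have "\<dots> = (b - c1) * r" by (simp add: algebra_simps)
    finally have "b - c1 > 1" using \<open>r > 0\<close> by simp
    moreover have "b *\<^sub>R w = v - c1 *\<^sub>R u1" by (simp add: vw)
    then have "norm (b *\<^sub>R w) \<le> norm v + norm (c1 *\<^sub>R u1)" by (metis norm_triangle_ineq4)
    then have "b \<le> 1 + c1" using b c1 w unit by simp
    ultimately show False by simp
  qed
  show False
    using c(4) \<open>c1 \<noteq> 0\<close> main[of c2 u2] main[of c3 u3] c unit q v by auto
qed

text \<open>The triangle inequality gives \<open>a + b \<ge> 1\<close>, so the combination stays
  above \<open>r\<close>. Geometrically, normals of tangent lines that cut off \<open>p\<close> form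
  an arc.\<close>

lemma unit_in_cap:
  fixes v1 v2 u p :: "'a::real_inner"
  assumes "norm u = 1" "norm v1 = 1" "norm v2 = 1" "a \<ge> 0" "b \<ge> 0"
    and u: "u = a *\<^sub>R v1 + b *\<^sub>R v2" and "r \<ge> 0" "v1 \<bullet> p > r" "v2 \<bullet> p > r"
  shows "u \<bullet> p > r"
proof -
  have "1 \<le> a + b"
    using norm_triangle_ineq[of "a *\<^sub>R v1" "b *\<^sub>R v2"] assms by simp
  then have "r \<le> a * r + b * r" using assms(7) by (simp add: distrib_right[symmetric] mult_le_cancel_right1)
  also have "\<dots> < a * (v1 \<bullet> p) + b * (v2 \<bullet> p)"
  proof (cases "a > 0")
    case True
    then show ?thesis using assms by (intro add_less_le_mono mult_strict_left_mono mult_left_mono) auto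
  next
    case False
    then have "a = 0" "b > 0" using assms(4) \<open>1 \<le> a + b\<close> by auto
    then show ?thesis using assms by simp
  qed
  finally show ?thesis by (simp add: u inner_add_left)
qed

text \<open>Cramer's rule expresses \<open>v\<close> by \<open>u1\<close> and \<open>u2\<close>;
  subtracting a multiple of the positive relation repairs the signs. So the cones spanned by pairs
  of normals cover the plane.\<close>

lemma cone_decomposition:
  fixes u1 u2 u3 v :: "real^2"
  assumes l: "l1 > 0" "l2 > 0" "l3 > 0" "l1 *\<^sub>R u1 + l2 *\<^sub>R u2 + l3 *\<^sub>R u3 = 0"
    and det: "u1$1 * u2$2 - u1$2 * u2$1 \<noteq> 0"
  obtains c1 c2 c3 where "c1 \<ge> 0" "c2 \<ge> 0" "c3 \<ge> 0" "c1 = 0 \<or> c2 = 0 \<or> c3 = (0::real)"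
    "v = c1 *\<^sub>R u1 + c2 *\<^sub>R u2 + c3 *\<^sub>R u3"
proof -
  let ?d = "u1$1 * u2$2 - u1$2 * u2$1"
  define a b where "a = (v$1 * u2$2 - v$2 * u2$1) / ?d" and "b = (u1$1 * v$2 - u1$2 * v$1) / ?d"
  have ab: "v = a *\<^sub>R u1 + b *\<^sub>R u2"
    using det by (simp add: vec_eq_iff forall_2 a_def b_def add_divide_distrib[symmetric] eq_divide_eq)
      (simp add: algebra_simps)
  \<comment> \<open>The least ratio of coefficient to weight, the third being 0 because
    \<open>u3\<close> does not yet occur; the coefficient attaining it becomes zero.\<close>
  define m where "m = Min {a / l1, b / l2, 0}"
  have m: "m \<le> a / l1" "m \<le> b / l2" "m \<le> 0" "m = a / l1 \<or> m = b / l2 \<or> m = 0"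
    using Min_in[of "{a / l1, b / l2, 0}"] by (auto simp: m_def)
  have "v = a *\<^sub>R u1 + b *\<^sub>R u2 - m *\<^sub>R (l1 *\<^sub>R u1 + l2 *\<^sub>R u2 + l3 *\<^sub>R u3)"
    by (simp add: ab l(4))
  also have "\<dots> = (a - m * l1) *\<^sub>R u1 + (b - m * l2) *\<^sub>R u2 + (- m * l3) *\<^sub>R u3"
    by (simp add: algebra_simps)
  finally show ?thesis
    using m l by (intro that[of "a - m * l1" "b - m * l2" "- m * l3"])
      (auto simp: pos_le_divide_eq mult_nonpos_nonneg)
qed

text \<open>This is the algebraic form of the inball separating the deep points. \<open>v1\<close>
  lies in the cone of \<open>u2\<close> and \<open>u3\<close>, \<open>v2\<close> in that of
  \<open>u1\<close> and \<open>u3\<close>; unless they are opposite, the arc between them contains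
  \<open>u3\<close> or \<open>u1\<close>, which would put \<open>p\<close> beyond a contact
  tangent.\<close>

lemma no_common_escape:
  fixes u1 u2 u3 v1 v2 p q1 q2 q3 :: "real^2"
  assumes unit: "norm u1 = 1" "norm u2 = 1" "norm u3 = 1" "norm v1 = 1" "norm v2 = 1" and r: "r > 0"
    and l: "l1 \<ge> 0" "l2 \<ge> 0" "l3 \<ge> 0" "l1 + l2 + l3 = 1" "l1 *\<^sub>R u1 + l2 *\<^sub>R u2 + l3 *\<^sub>R u3 = 0"
    and q1: "u1 \<bullet> q1 < - r" "u2 \<bullet> q1 \<le> r" "u3 \<bullet> q1 \<le> r"
    and q2: "u2 \<bullet> q2 < - r" "u1 \<bullet> q2 \<le> r" "u3 \<bullet> q2 \<le> r"
    and q3: "u3 \<bullet> q3 < - r" "u1 \<bullet> q3 \<le> r" "u2 \<bullet> q3 \<le> r"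
    and p: "u1 \<bullet> p \<le> r" "u2 \<bullet> p \<le> r" "u3 \<bullet> p \<le> r"
    and v: "v1 \<bullet> q1 \<ge> r" "v1 \<bullet> p > r" "v2 \<bullet> q2 \<ge> r" "v2 \<bullet> p > r"
  shows False
proof -
  \<comment> \<open>Pairing the relation with a deep point excludes weights of 1/2 or more; hence
    all three weights are positive.\<close>
  have half: "a < 1 / 2"
    if "a \<ge> 0" "b \<ge> 0" "c \<ge> 0" "a + b + c = 1" "a *\<^sub>R x + b *\<^sub>R y + c *\<^sub>R z = 0"
      "x \<bullet> q < - r" "y \<bullet> q \<le> r" "z \<bullet> q \<le> r" for a b c and x y z q :: "real^2"
  proof (rule ccontr)
    assume "\<not> a < 1 / 2"
    then have a: "a > 0" "a \<ge> b + c" using that by auto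
    have "0 = (a *\<^sub>R x + b *\<^sub>R y + c *\<^sub>R z) \<bullet> q" using that(5) by simp
    also have "\<dots> = a * (x \<bullet> q) + (b * (y \<bullet> q) + c * (z \<bullet> q))" by (simp add: inner_add_left)
    also have "\<dots> < a * (- r) + (b * r + c * r)"
      using a that by (intro add_less_le_mono add_mono mult_strict_left_mono mult_left_mono) auto
    also have "\<dots> = (b + c - a) * r" by (simp add: algebra_simps)
    also have "\<dots> \<le> 0" using a r by (simp add: mult_nonpos_nonneg)
    finally show False by simp
  qed
  have h: "l1 < 1 / 2" "l2 < 1 / 2" "l3 < 1 / 2"
    using half[of l1 l2 l3 u1 u2 u3 q1] half[of l2 l1 l3 u2 u1 u3 q2] half[of l3 l1 l2 u3 u1 u2 q3]
      l q1 q2 q3 by (auto simp: add_ac)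
  have lp: "l1 > 0" "l2 > 0" "l3 > 0" using h l by auto
  have det: "u1$1 * u2$2 - u1$2 * u2$1 \<noteq> 0"
  proof
    assume 0: "u1$1 * u2$2 - u1$2 * u2$1 = 0"
    \<comment> \<open>By Lagrange's identity a zero determinant makes \<open>u1\<close> and
      \<open>u2\<close> equal or opposite. Equal normals would force \<open>l3 = 1 / 2\<close>;
      opposite ones would put \<open>q1\<close> beyond the second tangent.\<close>
    have "(u1 \<bullet> u2)\<^sup>2 + (u1$1 * u2$2 - u1$2 * u2$1)\<^sup>2 = (u1 \<bullet> u1) * (u2 \<bullet> u2)"
      by (simp add: inner_vec_def sum_2 algebra_simps power2_eq_square)
    also have "\<dots> = 1" using unit by (simp add: norm_eq_1)
    finally have "(u1 \<bullet> u2)\<^sup>2 = 1" using 0 by simp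
    then have "u1 \<bullet> u2 = 1 \<or> u1 \<bullet> u2 = - 1" by (simp add: power2_eq_1_iff)
    then show False
    proof
      assume "u1 \<bullet> u2 = 1"
      then have "(u1 - u2) \<bullet> (u1 - u2) = 0"
        using unit by (simp add: norm_eq_1 algebra_simps inner_commute)
      then have "u2 = u1" by simp
      then have "(l1 + l2) *\<^sub>R u1 = - (l3 *\<^sub>R u3)"
        using l(5) by (simp add: scaleR_add_left eq_neg_iff_add_eq_0)
      then have "norm ((l1 + l2) *\<^sub>R u1) = norm (l3 *\<^sub>R u3)" by (simp add: norm_minus_cancel)
      then show False using unit lp h l by simp
    next
      assume "u1 \<bullet> u2 = - 1"
      then have "(u1 + u2) \<bullet> (u1 + u2) = 0"
        using unit by (simp add: norm_eq_1 algebra_simps inner_commute)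
      then have "u2 = - u1" by (simp add: add_eq_0_iff)
      then show False using q1 by simp
    qed
  qed
  obtain c1 c2 c3 where c: "c1 \<ge> 0" "c2 \<ge> 0" "c3 \<ge> 0" "c1 = 0 \<or> c2 = 0 \<or> c3 = 0"
    "v1 = c1 *\<^sub>R u1 + c2 *\<^sub>R u2 + c3 *\<^sub>R u3" using cone_decomposition[OF lp l(5) det] .
  obtain d1 d2 d3 where d: "d1 \<ge> 0" "d2 \<ge> 0" "d3 \<ge> 0" "d1 = 0 \<or> d2 = 0 \<or> d3 = 0"
    "v2 = d1 *\<^sub>R u1 + d2 *\<^sub>R u2 + d3 *\<^sub>R u3" using cone_decomposition[OF lp l(5) det] .
  have "c1 = 0"
    using cone_coefficient_zero[OF unit(1-4) r c q1 v(1)] .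
  then have v1: "v1 = c2 *\<^sub>R u2 + c3 *\<^sub>R u3" using c(5) by simp
  have "d2 = 0"
    using cone_coefficient_zero[of u2 u1 u3 v2 r d2 d1 d3 q2] unit r d q2 v(3) by (auto simp: add_ac)
  then have v2: "v2 = d1 *\<^sub>R u1 + d3 *\<^sub>R u3" using d(5) by simp
  have "c2 \<noteq> 0"
  proof
    assume "c2 = 0"
    then have "v1 = c3 *\<^sub>R u3" "c3 = 1" using v1 unit c(3) by auto
    then show False using v(2) p(3) by simp
  qed
  have "d1 \<noteq> 0"
  proof
    assume "d1 = 0"
    then have "v2 = d3 *\<^sub>R u3" "d3 = 1" using v2 unit d(3) by auto
    then show False using v(4) p(3) by simp
  qed
  have cd: "c2 > 0" "d1 > 0" using \<open>c2 \<noteq> 0\<close> \<open>d1 \<noteq> 0\<close> c d by auto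
  \<comment> \<open>With these weights \<open>u1\<close> and \<open>u2\<close> occur in the sum in
    the ratio of \<open>l1\<close> to \<open>l2\<close>, so the relation leaves a multiple of
    \<open>u3\<close>.\<close>
  define a b s where "a = l2 * d1" and "b = l1 * c2"
    and "s = l2 * d1 * c3 + l1 * c2 * d3 - c2 * d1 * l3"
  have ab: "a > 0" "b > 0" using cd lp by (simp_all add: a_def b_def)
  have "a *\<^sub>R v1 + b *\<^sub>R v2 = s *\<^sub>R u3 + (c2 * d1) *\<^sub>R (l1 *\<^sub>R u1 + l2 *\<^sub>R u2 + l3 *\<^sub>R u3)"
    by (simp add: v1 v2 a_def b_def s_def algebra_simps)
  then have rel: "a *\<^sub>R v1 + b *\<^sub>R v2 = s *\<^sub>R u3" by (simp add: l(5))
  \<comment> \<open>the arc of normals separating p from the ball contains v1 and v2, hence also u3 or u1\<close>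
  have "s = 0 \<or> s > 0 \<or> s < 0" by auto
  then show False
  proof (elim disjE)
    assume "s = 0"
    then have "a * (v1 \<bullet> p) + b * (v2 \<bullet> p) = 0"
      using arg_cong[OF rel, of "\<lambda>z. z \<bullet> p"] by (simp add: inner_add_left)
    moreover have "a * (v1 \<bullet> p) > 0" "b * (v2 \<bullet> p) > 0" using ab v r by auto
    ultimately show False by simp
  next
    assume s: "s > 0"
    have "u3 = (1 / s) *\<^sub>R (s *\<^sub>R u3)" using s by simp
    also have "\<dots> = (a / s) *\<^sub>R v1 + (b / s) *\<^sub>R v2"
      unfolding rel[symmetric] by (simp add: scaleR_add_right)
    finally have "u3 \<bullet> p > r"
      using unit_in_cap[OF unit(3-5), of "a / s" "b / s"] s ab v r by simp
    then show False using p by simp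
  next
    \<comment> \<open>Now \<open>- u3\<close> lies in the cone of \<open>v1\<close> and
      \<open>v2\<close>, hence so does \<open>u1\<close>, a positive multiple of
      \<open>v2 + d3 *\<^sub>R (- u3)\<close>.\<close>
    assume s: "s < 0"
    define a' b' where "a' = a / - s" and "b' = b / - s"
    have "- u3 = (1 / - s) *\<^sub>R (s *\<^sub>R u3)" using s by simp
    also have "\<dots> = a' *\<^sub>R v1 + b' *\<^sub>R v2"
      unfolding rel[symmetric] by (simp add: scaleR_add_right a'_def b'_def)
    finally have u3: "- u3 = a' *\<^sub>R v1 + b' *\<^sub>R v2" .
    have "u1 = (1 / d1) *\<^sub>R (v2 + d3 *\<^sub>R (- u3))" using cd by (simp add: v2)
    also have "\<dots> = (d3 * a' / d1) *\<^sub>R v1 + ((1 + d3 * b') / d1) *\<^sub>R v2"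
      unfolding u3 by (simp add: scaleR_add_right scaleR_add_left add_divide_distrib)
    finally have eq: "u1 = (d3 * a' / d1) *\<^sub>R v1 + ((1 + d3 * b') / d1) *\<^sub>R v2" .
    have "d3 * a' \<ge> 0" "d3 * b' \<ge> 0"
      using s ab d(3) unfolding a'_def b'_def by (intro mult_nonneg_nonneg divide_nonneg_pos; simp)+
    then have "d3 * a' / d1 \<ge> 0" "(1 + d3 * b') / d1 \<ge> 0"
      using cd by auto
    then have "u1 \<bullet> p > r"
      using unit_in_cap[OF unit(1,4,5) _ _ eq] v r by simp
    then show False using p by simp
  qed
qed

section \<open>Three deep points against the two ends of a diameter\<close>

theorem theorem3p4:
  fixes K :: "(real^2) set"
  assumes "convex_body K"
  shows "min_width K \<le> inradius K * (1 + (2 * sqrt 2 * circumradius K / diam K) *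
           sqrt (1 + sqrt (1 - (diam K / (2 * circumradius K))^2)))"
proof (rule ccontr)
  assume neg: "\<not> ?thesis"
  define D R where "D = diameter K" and "R = circumradius K"
  \<comment> \<open>For D = 2 R sin g these are \<open>\<kappa>\<close> = cos g and \<open>t\<close>
    = 1 / sin (g/2); \<open>tk\<close> below is the half-angle identity.\<close>
  define \<kappa> where "\<kappa> = sqrt (1 - (D / (2 * R))\<^sup>2)"
  define t where "t = 2 * sqrt 2 * R / D * sqrt (1 + \<kappa>)"
  obtain c r u1 u2 u3 l1 l2 l3 where r: "r > 0" "cball c r \<subseteq> K" "inradius K = r"
    and u: "norm u1 = 1" "norm u2 = 1" "norm u3 = 1"
    and l: "l1 \<ge> 0" "l2 \<ge> 0" "l3 \<ge> 0" "l1 + l2 + l3 = 1"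
      "l1 *\<^sub>R u1 + l2 *\<^sub>R u2 + l3 *\<^sub>R u3 = 0"
    and top: "\<And>x. x \<in> K \<Longrightarrow> u1 \<bullet> (x - c) \<le> r" "\<And>x. x \<in> K \<Longrightarrow> u2 \<bullet> (x - c) \<le> r"
      "\<And>x. x \<in> K \<Longrightarrow> u3 \<bullet> (x - c) \<le> r"
    by (rule convex_body_contact_normals[OF assms]) (rule that, assumption+)
  have cpt: "compact K" and bdd: "bounded K" and ne: "K \<noteq> {}"
    using assms by (auto simp: convex_body_def compact_imp_bounded)
  obtain x y where xy: "x \<in> K" "y \<in> K" "norm (x - y) = D"
    using diameter_compact_attained[OF cpt ne] by (auto simp: D_def dist_norm)
  have "diameter (cball c r) \<le> D" unfolding D_def using r(2) bdd by (rule diameter_subset)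
  then have D: "D > 0" using r(1) by (simp add: diameter_cball)
  have DR: "D \<le> 2 * R" unfolding D_def R_def using bdd ne by (rule diameter_le_circumradius)
  then have R: "R > 0" using D by simp
  have ratio: "(D / (2 * R))\<^sup>2 \<le> 1" using D R DR by (intro power_le_one) auto
  have k0: "\<kappa> \<ge> 0" using ratio by (simp add: \<kappa>_def)
  have k2: "\<kappa>\<^sup>2 = 1 - (D / (2 * R))\<^sup>2" using ratio by (simp add: \<kappa>_def)
  have t0: "t \<ge> 0" using D R k0 by (simp add: t_def)
  have "t\<^sup>2 * (1 - \<kappa>) = 8 * R\<^sup>2 / D\<^sup>2 * (1 - \<kappa>\<^sup>2)"
    using k0 by (simp add: t_def power_mult_distrib power_divide algebra_simps power2_eq_square)
  also have "\<dots> = 2" using D R by (simp add: k2 field_simps)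
  finally have tk: "t\<^sup>2 * (1 - \<kappa>) = 2" .
  have t1: "t \<ge> 1"
  proof (rule ccontr)
    assume "\<not> t \<ge> 1"
    then have "t\<^sup>2 \<le> 1" using t0 by (simp add: power_le_one)
    then have "t\<^sup>2 * (1 - \<kappa>) \<le> 1"
      using k0 by (smt (verit) mult_left_le zero_le_power2)
    with tk show False by simp
  qed
  have w: "min_width K > r + t * r"
    using neg r(3) by (simp add: t_def \<kappa>_def D_def R_def diam_def algebra_simps)
  have tr: "t * r \<ge> r" using t1 r(1) by simp
  \<comment> \<open>\<open>E p q\<close> provides a tangent line of the inball past which
    \<open>p\<close> can be joined to \<open>q\<close>.\<close>
  define E where "E p q \<longleftrightarrow> (\<exists>v. norm v = 1 \<and> v \<bullet> (q - c) \<ge> r \<and> v \<bullet> (p - c) > r)" for p q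
  have escape: "E x q \<or> E y q" if "q \<in> K" "norm u = 1" "u \<bullet> (q - c) < - (t * r)" for q u
  proof -
    have "norm (q - c) > t * r"
      using Cauchy_Schwarz_ineq2[of u "q - c"] that by simp
    moreover have "((x - c) - (q - c)) \<bullet> ((y - c) - (q - c))
        \<le> \<kappa> * (norm ((x - c) - (q - c)) * norm ((y - c) - (q - c)))"
      using diametral_pair_angle[OF bdd xy(1,2) that(1)] xy(3) D
      by (simp add: \<kappa>_def D_def R_def)
    ultimately show ?thesis
      using tangent_escape[OF r(1) k0 t0 tk] unfolding E_def by blast
  qed
  obtain q1 where q1: "q1 \<in> K" "u1 \<bullet> (q1 - c) < - (t * r)"
    using support_deep_point[OF bdd ne u(1) top(1) w] .
  obtain q2 where q2: "q2 \<in> K" "u2 \<bullet> (q2 - c) < - (t * r)"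
    using support_deep_point[OF bdd ne u(2) top(2) w] .
  obtain q3 where q3: "q3 \<in> K" "u3 \<bullet> (q3 - c) < - (t * r)"
    using support_deep_point[OF bdd ne u(3) top(3) w] .
  have deep: "u1 \<bullet> (q1 - c) < - r" "u2 \<bullet> (q2 - c) < - r" "u3 \<bullet> (q3 - c) < - r"
    using q1 q2 q3 tr by linarith+
  have l': "l1 + l3 + l2 = 1" "l1 *\<^sub>R u1 + l3 *\<^sub>R u3 + l2 *\<^sub>R u2 = 0"
    "l2 + l3 + l1 = 1" "l2 *\<^sub>R u2 + l3 *\<^sub>R u3 + l1 *\<^sub>R u1 = 0"
    using l(4,5) by (simp_all add: add_ac)
  \<comment> \<open>One application for each pair of deep points; the remaining index supplies the
    third normal and deep point.\<close>
  have "\<not> (E p q1 \<and> E p q2)" "\<not> (E p q1 \<and> E p q3)" "\<not> (E p q2 \<and> E p q3)" if "p \<in> K" for p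
    unfolding E_def
    using no_common_escape[OF u(1,2,3) _ _ r(1) l deep(1) top(2,3)[OF q1(1)] deep(2) top(1,3)[OF q2(1)]
        deep(3) top(1,2)[OF q3(1)] top(1,2,3)[OF that]]
      no_common_escape[OF u(1,3,2) _ _ r(1) l(1,3,2) l'(1,2) deep(1) top(3,2)[OF q1(1)]
        deep(3) top(1,2)[OF q3(1)] deep(2) top(1,3)[OF q2(1)] top(1,3,2)[OF that]]
      no_common_escape[OF u(2,3,1) _ _ r(1) l(2,3,1) l'(3,4) deep(2) top(3,1)[OF q2(1)]
        deep(3) top(2,1)[OF q3(1)] deep(1) top(2,3)[OF q1(1)] top(2,3,1)[OF that]]
    by blast+
  \<comment> \<open>Pigeonhole: each of the three deep points is reached from \<open>x\<close> or
    \<open>y\<close>, but each of these reaches at most one.\<close>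
  with escape[OF q1(1) u(1) q1(2)] escape[OF q2(1) u(2) q2(2)] escape[OF q3(1) u(3) q3(2)] xy(1,2)
  show False by blast
qed

end
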